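(* Let $(X,\circ)$ be a group with neutral element $1$, let $z\in X$ be fixed, and let $\check r:X\times X\to X\times X$, $\check r(x,y)=(\sigma_x(y),\tau_y(x))$, be an invertible non-degenerate solution of the set-theoretic braid equation. Let its inverse be $\check r^{-1}(x,y)=(\hat\sigma_x(y),\hat\tau_y(x))$, where all $\hat\sigma_x,\hat\tau_y$ are bijections of $X$. Define the binary operation $+$ on $X$ by $$y+x:=x\circ\sigma_{x^{-1}}(y\circ z)\circ z^{-1},$$ and suppose that there are $z_1,z_2,\xi\in X$ such that $\hat\sigma_x(y)=x\circ(x^{-1}\circ z_2+y\circ z_1)\circ\xi$ for all $x,y\in X$. Assume that: (A) $(X,+)$ is a group, with neutral element denoted $0$. (B) There exists $\phi:X\to X$ such that for all $a,b,c\in X$, $a\circ(b+c)=a\circ b+\phi(a)+a\circ c$. (C) There exists $\widehat\phi:X\to X$ such that for each $h\in\{z,\xi\}$ and all $a,b\in X$, $(a+b)\circ h=a\circ h+\widehat\phi(h)+b\circ h$. (D) The neutral element $0$ of $(X,+)$ has left and right distributivity. Then for all $a,b\in X$ the following hold: (1) $\phi(a)=-a\circ 0$, and $\widehat\phi(h)=-0\circ h$ for $h\in\{z,\xi\}$. (2) $\sigma_a(b)=(a\circ b\circ z^{-1}-a\circ 0+1)\circ z=a\circ b-a\circ 0\circ z+z$. (3) $a-a\circ 0=1$; moreover (i) $0\circ 0=-1$ and (ii) $1+1=0^{-1}$. (4) If $z_2\circ\xi=0^{-1}$ and $0\circ\xi=z_1\circ\xi=z^{-1}\circ 0^{-1}$,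 then (i) $\hat\sigma_a(b)\circ\hat\tau_b(a)=a\circ b=\sigma_a(b)\circ\tau_b(a)$ and (ii) $-a\circ 0+a=1$.
   Context: A map $\check r:X\times X\to X\times X$, $\check r(x,y)=(\sigma_x(y),\tau_y(x))$, is a solution of the (set-theoretic) braid equation if $(\check r\times\mathrm{id})(\mathrm{id}\times\check r)(\check r\times\mathrm{id})=(\mathrm{id}\times\check r)(\check r\times\mathrm{id})(\mathrm{id}\times\check r)$ on $X\times X\times X$. It is non-degenerate if all maps $\sigma_x$ and $\tau_y$ are bijections of $X$. The maps $\sigma_x,\tau_y$ may depend on the fixed parameter $z$, which is suppressed in the notation. Here $x^{-1}$ is the inverse of $x$ in $(X,\circ)$ and $-x$ is the inverse of $x$ in $(X,+)$. The operation $\circ$ binds more tightly than $+$ and $-$, so e.g. $-a\circ b$ means $-(a\circ b)$ and $a-b$ means $a+(-b)$. An element $h\in X$ has left distributivity if there is $\psi\in X$ with $h\circ(a+b)=h\circ a+\psi+h\circ b$ for all $a,b\in X$, and right distributivity if there is $\psi'\in X$ with $(a+b)\circ h=a\circ h+\psi'+b\circ h$ for all $a,b\in X$. *)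

theory Defs
  imports "HOL-Algebra.Ring"
begin

text \<open>
  The two group structures on the set X are packaged in a HOL-Algebra ring record R, used purely as
  a signature: (carrier, mult, one) is the group of the circle operation with neutral element 1, and
  (carrier, add, zero) is the second structure, with neutral element 0. Neither commutativity of the
  addition nor any ring law is assumed. The library notions \<^term>\<open>add_monoid R\<close>,
  \<^term>\<open>a_inv R\<close> (negation) and \<^term>\<open>a_minus R\<close> (a + (-b)) make
  sense in this generality.
\<close>

definition braiding_map :: "('a \<Rightarrow> 'a \<Rightarrow> 'a) \<Rightarrow> ('a \<Rightarrow> 'a \<Rightarrow> 'a) \<Rightarrow> 'a \<times> 'a \<Rightarrow> 'a \<times> 'a" where
  "braiding_map \<sigma> \<tau> = (\<lambda>(x, y). (\<sigma> x y, \<tau> y x))"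

text \<open>Triples are nested to the right, so \<open>id \<times> r\<close> is \<open>map_prod id r\<close>,
  while \<open>r \<times> id\<close> needs a reassociation.\<close>

definition times_id :: "('a \<times> 'a \<Rightarrow> 'a \<times> 'a) \<Rightarrow> 'a \<times> 'a \<times> 'a \<Rightarrow> 'a \<times> 'a \<times> 'a" where
  "times_id r = (\<lambda>(x, y, w). case r (x, y) of (u, v) \<Rightarrow> (u, v, w))"

definition id_times :: "('a \<times> 'a \<Rightarrow> 'a \<times> 'a) \<Rightarrow> 'a \<times> 'a \<times> 'a \<Rightarrow> 'a \<times> 'a \<times> 'a" where
  "id_times r = map_prod id r"

definition braid_solution :: "'a set \<Rightarrow> ('a \<times> 'a \<Rightarrow> 'a \<times> 'a) \<Rightarrow> bool" where
  "braid_solution X r \<longleftrightarrow>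
     r \<in> X \<times> X \<rightarrow> X \<times> X \<and>
     (\<forall>t \<in> X \<times> X \<times> X.
        (times_id r \<circ> id_times r \<circ> times_id r) t = (id_times r \<circ> times_id r \<circ> id_times r) t)"

text \<open>Applied to a solution this is non-degeneracy; the same condition is imposed on the
  components of the inverse map.\<close>

definition nondegenerate :: "'a set \<Rightarrow> ('a \<Rightarrow> 'a \<Rightarrow> 'a) \<Rightarrow> ('a \<Rightarrow> 'a \<Rightarrow> 'a) \<Rightarrow> bool" where
  "nondegenerate X \<sigma> \<tau> \<longleftrightarrow> (\<forall>x\<in>X. bij_betw (\<sigma> x) X X) \<and> (\<forall>y\<in>X. bij_betw (\<tau> y) X X)"

definition left_distributivity :: "('a, 'b) ring_scheme \<Rightarrow> 'a \<Rightarrow> bool" where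
  "left_distributivity R h \<longleftrightarrow>
     (\<exists>\<psi>\<in>carrier R. \<forall>a\<in>carrier R. \<forall>b\<in>carrier R.
        h \<otimes>\<^bsub>R\<^esub> (a \<oplus>\<^bsub>R\<^esub> b) = h \<otimes>\<^bsub>R\<^esub> a \<oplus>\<^bsub>R\<^esub> \<psi> \<oplus>\<^bsub>R\<^esub> h \<otimes>\<^bsub>R\<^esub> b)"

definition right_distributivity :: "('a, 'b) ring_scheme \<Rightarrow> 'a \<Rightarrow> bool" where
  "right_distributivity R h \<longleftrightarrow>
     (\<exists>\<psi>\<in>carrier R. \<forall>a\<in>carrier R. \<forall>b\<in>carrier R.
        (a \<oplus>\<^bsub>R\<^esub> b) \<otimes>\<^bsub>R\<^esub> h = a \<otimes>\<^bsub>R\<^esub> h \<oplus>\<^bsub>R\<^esub> \<psi> \<oplus>\<^bsub>R\<^esub> b \<otimes>\<^bsub>R\<^esub> h)"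

end

theory Submission
  imports Defs
begin

text \<open>
  Conditions (B) and (C) say that left multiplications and right multiplications by z and \<open>\<xi>\<close>
  are homomorphisms of the heap operation \<open>x - y + w\<close>, which turns \<open>\<sigma>\<close> and \<open>\<sigma>h\<close> into
  explicit heap expressions. The first component of the braid equation reads
  \<open>\<sigma> a \<circ> \<sigma> b = \<sigma> (\<sigma> a b) \<circ> \<sigma> (\<tau> b a)\<close>. Evaluated where \<open>\<sigma> b\<close> does not depend on b, it shows by
  non-degeneracy that \<open>\<sigma> a d\<close> does not depend on a, for a suitable d. For \<open>\<sigma>\<close> this gives (3); for
  \<open>\<sigma>h\<close>, the inverse map being a solution too, it gives centrality of 1 in the additive group,
  which is (4)(ii). Finally (4)(i) is what \<open>\<sigma>h (\<sigma> a b) (\<tau> b a) = a\<close> says once both sides are made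
  explicit.
\<close>

section \<open>Set-theoretic solutions of the braid equation and their inverses\<close>

lemma braid_solution_closed:
  assumes "braid_solution X (braiding_map s t)" "a \<in> X" "b \<in> X"
  shows "s a b \<in> X" "t b a \<in> X"
proof -
  have "braiding_map s t (a, b) \<in> X \<times> X"
    using assms unfolding braid_solution_def by blast
  then show "s a b \<in> X" "t b a \<in> X"
    by (auto simp: braiding_map_def)
qed

lemma braid_solution_fst:
  assumes "braid_solution X (braiding_map s t)" "a \<in> X" "b \<in> X" "c \<in> X"
  shows "s a (s b c) = s (s a b) (s (t b a) c)"
proof -
  let ?r = "braiding_map s t"
  have "(times_id ?r \<circ> id_times ?r \<circ> times_id ?r) (a, b, c)
      = (id_times ?r \<circ> times_id ?r \<circ> id_times ?r) (a, b, c)"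
    using assms unfolding braid_solution_def by blast
  then show ?thesis
    by (simp add: braiding_map_def times_id_def id_times_def)
qed

text \<open>Surjectivity of \<open>s a\<close> writes \<open>a'\<close> as \<open>s a b\<close>. In
  \<open>braid_solution_fst\<close> at \<open>c\<close>, both inner values, \<open>s b c\<close> and
  \<open>s (t b a) c\<close>, are then \<open>d\<close>.\<close>

lemma braid_solution_const:
  assumes braid: "braid_solution X (braiding_map s t)"
    and nondeg: "nondegenerate X s t"
    and c: "c \<in> X" "\<And>b. b \<in> X \<Longrightarrow> s b c = d"
    and a: "a \<in> X" "a' \<in> X"
  shows "s a d = s a' d"
proof -
  have "a' \<in> s a ` X"
    using nondeg a by (auto simp: nondegenerate_def bij_betw_def)
  then obtain b where b: "b \<in> X" "s a b = a'" by blast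
  have "t b a \<in> X"
    using braid_solution_closed[OF braid] a b by blast
  with braid_solution_fst[OF braid a(1) b(1) c(1)] b c(2) show ?thesis
    by simp
qed

text \<open>Each side of the braid equation is a palindrome in \<open>times_id r\<close> and
  \<open>id_times r\<close>, so inverting both sides gives the same equation for
  \<open>s\<close>.\<close>

lemma braid_solution_inverse:
  assumes braid: "braid_solution X r"
    and s: "s \<in> X \<times> X \<rightarrow> X \<times> X"
    and sr: "\<And>p. p \<in> X \<times> X \<Longrightarrow> s (r p) = p"
    and rs: "\<And>p. p \<in> X \<times> X \<Longrightarrow> r (s p) = p"
  shows "braid_solution X s"
proof -
  let ?X3 = "X \<times> X \<times> X"
  have r: "r \<in> X \<times> X \<rightarrow> X \<times> X"
    and eq: "\<And>t. t \<in> ?X3 \<Longrightarrow>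
      times_id r (id_times r (times_id r t)) = id_times r (times_id r (id_times r t))"
    using braid by (auto simp: braid_solution_def)
  have closed: "times_id f t \<in> ?X3" "id_times f t \<in> ?X3"
    if "f \<in> X \<times> X \<rightarrow> X \<times> X" "t \<in> ?X3" for f t
    using that by (fastforce simp: times_id_def id_times_def Pi_iff split: prod.splits)+
  have cancel: "times_id f (times_id g t) = t" "id_times f (id_times g t) = t"
    if "\<And>p. p \<in> X \<times> X \<Longrightarrow> f (g p) = p" "t \<in> ?X3" for f g t
    using that by (auto simp: times_id_def id_times_def split: prod.splits)
       (metis SigmaI prod.inject)+
  note [simp] = closed[OF r] closed[OF s] cancel[of s r, OF sr] cancel[of r s, OF rs]
  have "times_id s (id_times s (times_id s t)) = id_times s (times_id s (id_times s t))"
    if t: "t \<in> ?X3" for t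
  proof -
    define u where "u = times_id s (id_times s (times_id s t))"
    have u: "u \<in> ?X3" using t by (simp add: u_def)
    have "t = times_id r (id_times r (times_id r u))"
      using t by (simp add: u_def)
    also have "\<dots> = id_times r (times_id r (id_times r u))"
      by (rule eq[OF u])
    finally have "id_times s (times_id s (id_times s t)) = u"
      using u by simp
    then show ?thesis by (simp add: u_def)
  qed
  then show ?thesis using s by (simp add: braid_solution_def)
qed

section \<open>Two group structures on one set and heap homomorphisms\<close>

locale double_group =
  fixes R :: "('a, 'b) ring_scheme" (structure)
  assumes circ_group: "group R"
    and add_group: "group (add_monoid R)"
begin

sublocale circ: group R
  by (rule circ_group)

text \<open>The rewrites put the group facts into ring notation; only facts valid for a possibly
  noncommutative addition become available.\<close>

sublocale add: group "add_monoid R"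
  rewrites "carrier (add_monoid R) = carrier R"
    and "mult (add_monoid R) = add R"
    and "one (add_monoid R) = zero R"
    and "m_inv (add_monoid R) = a_inv R"
  by (rule add_group) (simp_all add: a_inv_def)

lemma add_cancel_left [simp]:
  assumes "x \<in> carrier R" "y \<in> carrier R"
  shows "x \<oplus> (\<ominus> x \<oplus> y) = y" "\<ominus> x \<oplus> (x \<oplus> y) = y"
  using assms by (simp_all flip: add.m_assoc)

lemma circ_cancel_left [simp]:
  assumes "x \<in> carrier R" "y \<in> carrier R"
  shows "x \<otimes> (inv x \<otimes> y) = y" "inv x \<otimes> (x \<otimes> y) = y"
  using assms by (simp_all flip: circ.m_assoc)

lemmas heap_simps = a_minus_def add.m_assoc add.inv_mult_group

text \<open>Stated for an arbitrary \<open>f\<close>, so that left and right multiplications are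
  both instances; the case \<open>b = c = \<zero>\<close> determines \<open>k\<close>.\<close>

lemma affine_offset:
  assumes f: "f \<in> carrier R \<rightarrow> carrier R" and k: "k \<in> carrier R"
    and aff: "\<And>b c. b \<in> carrier R \<Longrightarrow> c \<in> carrier R \<Longrightarrow> f (b \<oplus> c) = f b \<oplus> k \<oplus> f c"
  shows "k = \<ominus> f \<zero>"
proof -
  have f0: "f \<zero> \<in> carrier R" using f by auto
  have "f \<zero> = f \<zero> \<oplus> k \<oplus> f \<zero>" using aff[of \<zero> \<zero>] by simp
  then have "k \<oplus> f \<zero> = \<zero>" using f0 k by (simp add: add.m_assoc)
  then show ?thesis using f0 k by (simp add: add.inv_equality)
qed

text \<open>Expanding \<open>f (y \<oplus> \<ominus> y)\<close> gives
  \<open>f (\<ominus> y) = f \<zero> \<ominus> f y \<oplus> f \<zero>\<close>; the two copies of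
  \<open>f \<zero>\<close> cancel against the offsets \<open>k\<close>.\<close>

lemma affine_heap:
  assumes f: "f \<in> carrier R \<rightarrow> carrier R" and k: "k \<in> carrier R"
    and aff: "\<And>b c. b \<in> carrier R \<Longrightarrow> c \<in> carrier R \<Longrightarrow> f (b \<oplus> c) = f b \<oplus> k \<oplus> f c"
    and x: "x \<in> carrier R" "y \<in> carrier R" "w \<in> carrier R"
  shows "f (x \<ominus> y \<oplus> w) = f x \<ominus> f y \<oplus> f w"
proof -
  have k_eq: "k = \<ominus> f \<zero>" by (rule affine_offset[OF f k aff])
  have fc: "f v \<in> carrier R" if "v \<in> carrier R" for v using f that by auto
  have "f \<zero> = f y \<oplus> k \<oplus> f (\<ominus> y)" using aff[of y "\<ominus> y"] x by simp
  then have "\<ominus> k \<oplus> \<ominus> f y \<oplus> f \<zero> = f (\<ominus> y)" using x k fc by (simp add: add.m_assoc)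
  then have neg: "f (\<ominus> y) = f \<zero> \<oplus> \<ominus> f y \<oplus> f \<zero>"
    using x fc by (simp add: k_eq)
  show ?thesis
    using x fc by (simp add: a_minus_def aff neg k_eq add.m_assoc)
qed

text \<open>The inverse of a bijective heap homomorphism is one too: multiply the claimed value by
  \<open>h\<close> and cancel.\<close>

lemma right_heap_inv:
  assumes h: "h \<in> carrier R"
    and heap: "\<And>x y w. x \<in> carrier R \<Longrightarrow> y \<in> carrier R \<Longrightarrow> w \<in> carrier R \<Longrightarrow>
      (x \<ominus> y \<oplus> w) \<otimes> h = x \<otimes> h \<ominus> y \<otimes> h \<oplus> w \<otimes> h"
    and x: "x \<in> carrier R" "y \<in> carrier R" "w \<in> carrier R"
  shows "(x \<ominus> y \<oplus> w) \<otimes> inv h = x \<otimes> inv h \<ominus> y \<otimes> inv h \<oplus> w \<otimes> inv h"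
proof -
  have "(x \<otimes> inv h \<ominus> y \<otimes> inv h \<oplus> w \<otimes> inv h) \<otimes> h = x \<ominus> y \<oplus> w"
    using h x by (simp add: heap circ.m_assoc)
  then show ?thesis
    using h x by (metis a_minus_def add.inv_closed add.m_closed circ.inv_closed circ.inv_solve_right
        circ.m_closed)
qed

end

theorem theorem2p6:
  fixes R :: "('a, 'b) ring_scheme" (structure)
    and \<sigma> \<tau> \<sigma>h \<tau>h :: "'a \<Rightarrow> 'a \<Rightarrow> 'a"
    and \<phi> \<phi>h :: "'a \<Rightarrow> 'a"
    and z z\<^sub>1 z\<^sub>2 \<xi> :: 'a
  assumes circ_group: "group R"
    and z: "z \<in> carrier R"
    and solution: "braid_solution (carrier R) (braiding_map \<sigma> \<tau>)"
    and nondeg: "nondegenerate (carrier R) \<sigma> \<tau>"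
    and invertible: "bij_betw (braiding_map \<sigma> \<tau>) (carrier R \<times> carrier R) (carrier R \<times> carrier R)"
    and inverse: "\<forall>x\<in>carrier R. \<forall>y\<in>carrier R.
          inv_into (carrier R \<times> carrier R) (braiding_map \<sigma> \<tau>) (x, y) = (\<sigma>h x y, \<tau>h y x)"
    and inverse_nondeg: "nondegenerate (carrier R) \<sigma>h \<tau>h"
    and add_eq: "\<forall>x\<in>carrier R. \<forall>y\<in>carrier R.
          y \<oplus> x = x \<otimes> \<sigma> (inv x) (y \<otimes> z) \<otimes> inv z"
    and params: "z\<^sub>1 \<in> carrier R" "z\<^sub>2 \<in> carrier R" "\<xi> \<in> carrier R"
    and sigma_hat: "\<forall>x\<in>carrier R. \<forall>y\<in>carrier R.
          \<sigma>h x y = x \<otimes> (inv x \<otimes> z\<^sub>2 \<oplus> y \<otimes> z\<^sub>1) \<otimes> \<xi>"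
    and A: "group (add_monoid R)"
    and B: "\<phi> \<in> carrier R \<rightarrow> carrier R"
          "\<forall>a\<in>carrier R. \<forall>b\<in>carrier R. \<forall>c\<in>carrier R.
             a \<otimes> (b \<oplus> c) = a \<otimes> b \<oplus> \<phi> a \<oplus> a \<otimes> c"
    and C: "\<phi>h \<in> carrier R \<rightarrow> carrier R"
          "\<forall>h\<in>{z, \<xi>}. \<forall>a\<in>carrier R. \<forall>b\<in>carrier R.
             (a \<oplus> b) \<otimes> h = a \<otimes> h \<oplus> \<phi>h h \<oplus> b \<otimes> h"
    and D: "left_distributivity R \<zero>" "right_distributivity R \<zero>"
  shows "\<forall>a\<in>carrier R. \<forall>b\<in>carrier R.
      (\<phi> a = \<ominus> (a \<otimes> \<zero>) \<and> (\<forall>h\<in>{z, \<xi>}. \<phi>h h = \<ominus> (\<zero> \<otimes> h)))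
    \<and> (\<sigma> a b = (a \<otimes> b \<otimes> inv z \<ominus> a \<otimes> \<zero> \<oplus> \<one>) \<otimes> z
       \<and> (a \<otimes> b \<otimes> inv z \<ominus> a \<otimes> \<zero> \<oplus> \<one>) \<otimes> z = a \<otimes> b \<ominus> a \<otimes> \<zero> \<otimes> z \<oplus> z)
    \<and> (a \<ominus> a \<otimes> \<zero> = \<one> \<and> \<zero> \<otimes> \<zero> = \<ominus> \<one> \<and> \<one> \<oplus> \<one> = inv \<zero>)
    \<and> (z\<^sub>2 \<otimes> \<xi> = inv \<zero> \<and> \<zero> \<otimes> \<xi> = inv z \<otimes> inv \<zero> \<and> z\<^sub>1 \<otimes> \<xi> = inv z \<otimes> inv \<zero> \<longrightarrow>
         (\<sigma>h a b \<otimes> \<tau>h b a = a \<otimes> b \<and> a \<otimes> b = \<sigma> a b \<otimes> \<tau> b a)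
       \<and> \<ominus> (a \<otimes> \<zero>) \<oplus> a = \<one>)"
proof -
  let ?X = "carrier R"
  interpret double_group R by (rule double_group.intro[OF circ_group A])
  note zc [simp] = z and params [simp]

  \<comment> \<open>Heap form of the hypotheses and claims (1) to (3)\<close>
  have left: "a \<otimes> (x \<ominus> y \<oplus> w) = a \<otimes> x \<ominus> a \<otimes> y \<oplus> a \<otimes> w"
    if "a \<in> ?X" "x \<in> ?X" "y \<in> ?X" "w \<in> ?X" for a x y w
    using affine_heap[of "\<lambda>x. a \<otimes> x" "\<phi> a" x y w] B that by auto
  have \<phi>hc: "\<phi>h h \<in> ?X" if "h \<in> {z, \<xi>}" for h
    using C(1) that by auto
  have right: "(x \<ominus> y \<oplus> w) \<otimes> h = x \<otimes> h \<ominus> y \<otimes> h \<oplus> w \<otimes> h"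
    if "h \<in> {z, \<xi>}" "x \<in> ?X" "y \<in> ?X" "w \<in> ?X" for h x y w
    using affine_heap[of "\<lambda>x. x \<otimes> h" "\<phi>h h" x y w] C(2) \<phi>hc that by auto
  have \<phi>: "\<phi> a = \<ominus> (a \<otimes> \<zero>)" if "a \<in> ?X" for a
    using affine_offset[of "\<lambda>x. a \<otimes> x" "\<phi> a"] B that by auto
  have \<phi>h: "\<phi>h h = \<ominus> (\<zero> \<otimes> h)" if "h \<in> {z, \<xi>}" for h
    using affine_offset[of "\<lambda>x. x \<otimes> h" "\<phi>h h"] C(2) \<phi>hc that by auto
  have distrib: "a \<otimes> (x \<oplus> y) = a \<otimes> x \<ominus> a \<otimes> \<zero> \<oplus> a \<otimes> y"
    if "a \<in> ?X" "x \<in> ?X" "y \<in> ?X" for a x y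
    using that B(2) by (simp add: \<phi> a_minus_def)

  have \<sigma>1: "\<sigma> a b = (a \<otimes> b \<otimes> inv z \<ominus> a \<otimes> \<zero> \<oplus> \<one>) \<otimes> z" if ab: "a \<in> ?X" "b \<in> ?X" for a b
  proof -
    have \<sigma>c: "\<sigma> a b \<in> ?X" using braid_solution_closed[OF solution ab] by blast
    \<comment> \<open>Substituting \<open>inv a\<close> and \<open>b \<otimes> inv z\<close> into
      the definition of the addition solves it for \<open>\<sigma> a b\<close>.\<close>
    have "b \<otimes> inv z \<oplus> inv a = inv a \<otimes> \<sigma> a b \<otimes> inv z"
      using add_eq[rule_format, of "inv a" "b \<otimes> inv z"] ab by (simp add: circ.m_assoc)
    then have "\<sigma> a b = a \<otimes> (b \<otimes> inv z \<oplus> inv a) \<otimes> z"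
      using ab \<sigma>c by (simp add: circ.m_assoc)
    with ab show ?thesis by (simp add: distrib circ.m_assoc)
  qed
  have \<sigma>2: "(a \<otimes> b \<otimes> inv z \<ominus> a \<otimes> \<zero> \<oplus> \<one>) \<otimes> z = a \<otimes> b \<ominus> a \<otimes> \<zero> \<otimes> z \<oplus> z"
    if "a \<in> ?X" "b \<in> ?X" for a b
    using that by (simp add: right circ.m_assoc)

  have zero_shift: "a \<ominus> a \<otimes> \<zero> = \<one>" if a: "a \<in> ?X" for a
  proof -
    \<comment> \<open>At \<open>\<zero> \<otimes> z\<close> the first two terms of the heap formula
      \<open>\<sigma>2\<close> cancel, leaving the constant \<open>z\<close>. Hence
      \<open>\<sigma> a z\<close> does not depend on \<open>a\<close>, and comparison with
      \<open>a = \<one>\<close> gives the claim.\<close>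
    have "\<sigma> b (\<zero> \<otimes> z) = z" if "b \<in> ?X" for b
      using that by (simp add: \<sigma>1 \<sigma>2 heap_simps circ.m_assoc)
    from braid_solution_const[OF solution nondeg _ this a, of \<one>]
    have "\<sigma> a z = \<sigma> \<one> z" by simp
    then have "(a \<ominus> a \<otimes> \<zero> \<oplus> \<one>) \<otimes> z = (\<one> \<ominus> \<one> \<otimes> \<zero> \<oplus> \<one>) \<otimes> z"
      using a by (simp add: \<sigma>1 circ.m_assoc)
    then show ?thesis
      using a by (simp add: a_minus_def)
  qed
  \<comment> \<open>Right multiplication by \<open>\<zero>\<close> is an additive translation; so is
    its inverse, right multiplication by \<open>inv \<zero>\<close>, computed below.\<close>
  have zero_right: "a \<otimes> \<zero> = \<ominus> \<one> \<oplus> a" if a: "a \<in> ?X" for a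
  proof -
    have "\<ominus> (a \<ominus> a \<otimes> \<zero>) \<oplus> a = \<ominus> \<one> \<oplus> a" by (simp add: zero_shift a)
    then show ?thesis using a by (simp add: heap_simps)
  qed
  have zero_zero: "\<zero> \<otimes> \<zero> = \<ominus> \<one>" by (simp add: zero_right)
  have zero_inv_right: "a \<otimes> inv \<zero> = \<one> \<oplus> a" if a: "a \<in> ?X" for a
  proof -
    have "a = \<ominus> \<one> \<oplus> a \<otimes> inv \<zero>"
      using zero_right[of "a \<otimes> inv \<zero>"] a by (simp add: circ.m_assoc)
    then have "\<one> \<oplus> a = \<one> \<oplus> (\<ominus> \<one> \<oplus> a \<otimes> inv \<zero>)" by simp
    with a show ?thesis by simp
  qed
  have one_one: "\<one> \<oplus> \<one> = inv \<zero>" using zero_inv_right[of \<one>] by simp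

  have part4: "\<sigma>h a b \<otimes> \<tau>h b a = a \<otimes> b \<and> a \<otimes> b = \<sigma> a b \<otimes> \<tau> b a"
    "\<ominus> (a \<otimes> \<zero>) \<oplus> a = \<one>"
    if ab: "a \<in> ?X" "b \<in> ?X"
      and zs: "z\<^sub>2 \<otimes> \<xi> = inv \<zero>" "\<zero> \<otimes> \<xi> = inv z \<otimes> inv \<zero>" "z\<^sub>1 \<otimes> \<xi> = inv z \<otimes> inv \<zero>" for a b
  proof -
    have \<sigma>h: "\<sigma>h x y = \<one> \<oplus> \<one> \<ominus> x \<otimes> inv z \<oplus> x \<otimes> y \<otimes> inv z" if "x \<in> ?X" "y \<in> ?X" for x y
    proof -
      \<comment> \<open>The conditions on the parameters make every term a right multiple of
        \<open>inv \<zero>\<close>, hence a translate by \<open>\<one>\<close>; the two inner copies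
        of \<open>\<one>\<close> then cancel.\<close>
      have "\<sigma>h x y = z\<^sub>2 \<otimes> \<xi> \<ominus> x \<otimes> (\<zero> \<otimes> \<xi>) \<oplus> x \<otimes> y \<otimes> (z\<^sub>1 \<otimes> \<xi>)"
        using that by (simp add: sigma_hat distrib right circ.m_assoc)
      also have "\<dots> = inv \<zero> \<ominus> x \<otimes> inv z \<otimes> inv \<zero> \<oplus> x \<otimes> y \<otimes> inv z \<otimes> inv \<zero>"
        using that by (simp add: zs circ.m_assoc)
      also have "\<dots> = inv \<zero> \<ominus> (\<one> \<oplus> x \<otimes> inv z) \<oplus> (\<one> \<oplus> x \<otimes> y \<otimes> inv z)"
        using that by (simp add: zero_inv_right)
      also have "\<dots> = \<one> \<oplus> \<one> \<ominus> x \<otimes> inv z \<oplus> x \<otimes> y \<otimes> inv z"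
        using that by (simp add: heap_simps flip: one_one)
      finally show ?thesis .
    qed
    have inv1: "braiding_map \<sigma>h \<tau>h (braiding_map \<sigma> \<tau> p) = p"
      and inv2: "braiding_map \<sigma> \<tau> (braiding_map \<sigma>h \<tau>h p) = p"
      and invc: "braiding_map \<sigma>h \<tau>h p \<in> ?X \<times> ?X" if p: "p \<in> ?X \<times> ?X" for p
    proof -
      have eq: "braiding_map \<sigma>h \<tau>h q = inv_into (?X \<times> ?X) (braiding_map \<sigma> \<tau>) q" if "q \<in> ?X \<times> ?X" for q
        using that inverse by (auto simp: braiding_map_def)
      have "braiding_map \<sigma> \<tau> p \<in> ?X \<times> ?X" using invertible p by (auto simp: bij_betw_def)
      then show "braiding_map \<sigma>h \<tau>h (braiding_map \<sigma> \<tau> p) = p"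
        using bij_betw_inv_into_left[OF invertible p] by (simp add: eq)
      show "braiding_map \<sigma> \<tau> (braiding_map \<sigma>h \<tau>h p) = p"
        using bij_betw_inv_into_right[OF invertible p] p by (simp add: eq)
      show "braiding_map \<sigma>h \<tau>h p \<in> ?X \<times> ?X"
        using bij_betw_apply[OF bij_betw_inv_into[OF invertible] p] by (simp only: eq[OF p])
    qed
    have solution_h: "braid_solution ?X (braiding_map \<sigma>h \<tau>h)"
      by (rule braid_solution_inverse[OF solution _ inv1 inv2]) (use invc in auto)

    have prod: "x \<otimes> y = \<sigma> x y \<otimes> \<tau> y x" if xy: "x \<in> ?X" "y \<in> ?X" for x y
    proof -
      define u v where "u = \<sigma> x y" and "v = \<tau> y x"
      have uv: "u \<in> ?X" "v \<in> ?X"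
        using braid_solution_closed[OF solution xy] by (simp_all add: u_def v_def)
      have uz: "u \<otimes> inv z = x \<otimes> y \<otimes> inv z \<ominus> (\<ominus> \<one> \<oplus> x) \<oplus> \<one>"
        using xy by (simp add: u_def \<sigma>1 zero_right circ.m_assoc a_minus_def)
      have "x = \<sigma>h u v"
        using inv1[of "(x, y)"] xy by (simp add: braiding_map_def u_def v_def)
      \<comment> \<open>By \<open>uz\<close>, the negative of \<open>u \<otimes> inv z\<close>
        begins with \<open>\<ominus> \<one> \<ominus> \<one>\<close>, which absorbs the leading
        \<open>\<one> \<oplus> \<one>\<close> of \<open>\<sigma>h u v\<close>. Cancelling
        \<open>x\<close> then compares the two products.\<close>
      also have "\<dots> = x \<oplus> (\<ominus> (x \<otimes> y \<otimes> inv z) \<oplus> u \<otimes> v \<otimes> inv z)"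
        using xy uv by (simp add: \<sigma>h uz heap_simps)
      finally have "\<ominus> (x \<otimes> y \<otimes> inv z) \<oplus> u \<otimes> v \<otimes> inv z = \<zero>"
        using xy uv by simp
      then have "x \<otimes> y \<otimes> inv z = u \<otimes> v \<otimes> inv z"
        using xy uv by (metis add.inv_equality add.inv_inv add.inv_closed circ.inv_closed
            circ.m_closed zc add.inv_comm)
      then show ?thesis using xy uv by (simp add: u_def v_def)
    qed
    have "(\<sigma>h a b, \<tau>h b a) \<in> ?X \<times> ?X"
      using invc[of "(a, b)"] ab by (simp add: braiding_map_def)
    \<comment> \<open>The original map sends this pair back to \<open>(a, b)\<close>, so
      \<open>prod\<close> applies to it.\<close>
    then have "\<sigma>h a b \<otimes> \<tau>h b a = a \<otimes> b"
      using prod[of "\<sigma>h a b" "\<tau>h b a"] inv2[of "(a, b)"] ab by (simp add: braiding_map_def)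
    with prod ab show "\<sigma>h a b \<otimes> \<tau>h b a = a \<otimes> b \<and> a \<otimes> b = \<sigma> a b \<otimes> \<tau> b a" by blast

    \<comment> \<open>At \<open>\<one>\<close> the two terms involving \<open>b\<close> cancel, so
      \<open>\<sigma>h a (\<one> \<oplus> \<one>)\<close> is independent of \<open>a\<close>. It is
      compared with its value at \<open>\<zero>\<close>, where
      \<open>\<one> \<oplus> \<zero>\<close> collapses to \<open>\<one>\<close>.\<close>
    have "\<sigma>h b \<one> = \<one> \<oplus> \<one>" if "b \<in> ?X" for b
      using that by (simp add: \<sigma>h heap_simps)
    from braid_solution_const[OF solution_h inverse_nondeg _ this ab(1), of \<zero>]
    have "\<sigma>h a (\<one> \<oplus> \<one>) = \<sigma>h \<zero> (\<one> \<oplus> \<one>)" by simp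
    moreover have "x \<otimes> (\<one> \<oplus> \<one>) = \<one> \<oplus> x" if "x \<in> ?X" for x
      using that by (simp add: one_one zero_inv_right)
    ultimately have "\<ominus> (a \<otimes> inv z) \<oplus> (\<one> \<oplus> a) \<otimes> inv z = \<ominus> (\<zero> \<otimes> inv z) \<oplus> inv z"
      using ab by (simp add: \<sigma>h heap_simps)
    then have "a \<otimes> inv z \<oplus> (\<ominus> (a \<otimes> inv z) \<oplus> (\<one> \<oplus> a) \<otimes> inv z)
        = a \<otimes> inv z \<oplus> (\<ominus> (\<zero> \<otimes> inv z) \<oplus> inv z)"
      by simp
    then have "(\<one> \<oplus> a) \<otimes> inv z = a \<otimes> inv z \<ominus> \<zero> \<otimes> inv z \<oplus> \<one> \<otimes> inv z"
      using ab by (simp add: heap_simps)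
    \<comment> \<open>The heap law for \<open>inv z\<close> collects the right side into one
      multiple, so \<open>inv z\<close> cancels and \<open>\<one>\<close> commutes additively with
      \<open>a\<close>.\<close>
    also have "\<dots> = (a \<ominus> \<zero> \<oplus> \<one>) \<otimes> inv z"
      using right_heap_inv[of z a \<zero> \<one>] right ab by simp
    finally have "\<one> \<oplus> a = a \<oplus> \<one>"
      using ab by (simp add: a_minus_def)
    then show "\<ominus> (a \<otimes> \<zero>) \<oplus> a = \<one>"
      using ab by (simp add: zero_right heap_simps)
  qed
  show ?thesis
    using \<phi> \<phi>h \<sigma>1 \<sigma>2 zero_shift zero_zero one_one part4 by auto
qed

end
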